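(* For every integer $d>1$, the $d$-cube $C_d = [-1,1]^d$ exhibits an ML degree drop, i.e. $\mathrm{mldeg}(C_d) < \deg(C_d)$.
   Context: For a lattice polytope $P \subset \mathbb{R}^d$ with lattice points $P\cap\mathbb{Z}^d = \{a_1,\dots,a_n\}$, the design matrix is $A = [a_1\ \cdots\ a_n] \in \mathbb{Z}^{d\times n}$, and $A'$ is $A$ with an additional first row of ones. The toric variety $V = V_A\subseteq \mathbb{C}^n$ (standard scaling) is the Zariski closure of the image of $\psi:(\mathbb{C}^* )^{d+1}\to(\mathbb{C}^* )^n$, $(s,\theta)\mapsto (s\theta^{a_1},\dots,s\theta^{a_n})$. It is the affine cone over a projective toric variety; $\deg(P) := \deg(V)$ is its degree. For data $u\in\mathbb{N}^n$ with $u_+ = \sum_i u_i$, the score equations are $A'p = \frac{1}{u_+}A'u$ with $p\in V\cap(\mathbb{C}^* )^n$, and $\mathrm{mldeg}(P):=\mathrm{mldeg}(V)$ is the number of complex solutions $p$ for generic $u$. *)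

theory Defs
  imports
    "HOL-Analysis.Analysis"
    "HOL-Library.Poly_Mapping"
    "HOL-Computational_Algebra.Polynomial"
begin

text \<open>
  Affine \<open>n\<close>-space is indexed by a finite set \<open>I\<close> with \<open>n\<close> elements instead of \<open>{1..n}\<close>:
  its points are the elements of \<open>I \<rightarrow>\<^sub>E UNIV\<close>.  Elements of the polynomial ring over the complex
  numbers with variables \<open>x\<^sub>i\<close> are finitely supported maps from exponent vectors (themselves
  finitely supported) to coefficients.
\<close>

type_synonym 'i monom = "'i \<Rightarrow>\<^sub>0 nat"
type_synonym 'i cpoly = "'i monom \<Rightarrow>\<^sub>0 complex"

definition cpoly_eval :: "('i \<Rightarrow> complex) \<Rightarrow> 'i cpoly \<Rightarrow> complex" where
  "cpoly_eval p f = (\<Sum>m\<in>Poly_Mapping.keys f. Poly_Mapping.lookup f m *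
     (\<Prod>i\<in>Poly_Mapping.keys m. p i ^ Poly_Mapping.lookup m i))"

definition cpolys :: "'i set \<Rightarrow> 'i cpoly set" where
  "cpolys I = {f. \<forall>m\<in>Poly_Mapping.keys f. Poly_Mapping.keys m \<subseteq> I}"

definition vanishing_ideal :: "'i set \<Rightarrow> ('i \<Rightarrow> complex) set \<Rightarrow> 'i cpoly set" where
  "vanishing_ideal I S = {f \<in> cpolys I. \<forall>p\<in>S. cpoly_eval p f = 0}"

definition zariski_closure :: "'i set \<Rightarrow> ('i \<Rightarrow> complex) set \<Rightarrow> ('i \<Rightarrow> complex) set" where
  "zariski_closure I S =
     {p \<in> I \<rightarrow>\<^sub>E UNIV. \<forall>f\<in>vanishing_ideal I S. cpoly_eval p f = 0}"

definition cpoly_scale :: "complex \<Rightarrow> 'i cpoly \<Rightarrow> 'i cpoly" where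
  "cpoly_scale c f = Poly_Mapping.single 0 c * f"

interpretation cpoly: vector_space cpoly_scale
  by unfold_locales
    (simp_all add: cpoly_scale_def distrib_left distrib_right single_add mult_single
      flip: mult.assoc)

definition homogeneous_cpolys :: "'i set \<Rightarrow> nat \<Rightarrow> 'i cpoly set" where
  "homogeneous_cpolys I k = {f \<in> cpolys I. \<forall>m\<in>Poly_Mapping.keys f.
     (\<Sum>i\<in>Poly_Mapping.keys m. Poly_Mapping.lookup m i) = k}"

text \<open>
  The Hilbert function of a cone \<open>V\<close>: the dimension of the degree \<open>k\<close> part of the homogeneous
  coordinate ring (polynomial ring modulo vanishing ideal).  For finite \<open>I\<close> both dimensions are
  finite and the subtraction does not truncate.
\<close>

definition hilbert_function :: "'i set \<Rightarrow> ('i \<Rightarrow> complex) set \<Rightarrow> nat \<Rightarrow> nat" where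
  "hilbert_function I V k =
     cpoly.dim (homogeneous_cpolys I k) -
     cpoly.dim (homogeneous_cpolys I k \<inter> vanishing_ideal I V)"

definition hilbert_polynomial :: "'i set \<Rightarrow> ('i \<Rightarrow> complex) set \<Rightarrow> real poly" where
  "hilbert_polynomial I V =
     (THE h. \<forall>\<^sub>F k in sequentially. real (hilbert_function I V k) = poly h (real k))"

text \<open>
  The degree of the affine cone \<open>V\<close>, i.e. of the projective variety below it: with \<open>r\<close> the degree
  of the Hilbert polynomial (the dimension of the projective variety), \<open>r!\<close> times the leading
  coefficient.
\<close>

definition cone_degree :: "'i set \<Rightarrow> ('i \<Rightarrow> complex) set \<Rightarrow> real" where
  "cone_degree I V =
     fact (degree (hilbert_polynomial I V)) * lead_coeff (hilbert_polynomial I V)"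

text \<open>The columns of the design matrix are indexed by the lattice points themselves.\<close>

definition lattice_points :: "(real ^ 'd) set \<Rightarrow> (int ^ 'd) set" where
  "lattice_points P = {a. (\<chi> i. real_of_int (a $ i)) \<in> P}"

definition design_matrix :: "'d \<Rightarrow> int ^ 'd \<Rightarrow> int" where
  "design_matrix i a = a $ i"

fun extended_design_matrix :: "'d option \<Rightarrow> int ^ 'd \<Rightarrow> int" where
  "extended_design_matrix None a = 1"
| "extended_design_matrix (Some i) a = design_matrix i a"

definition toric_map ::
    "(real ^ 'd::finite) set \<Rightarrow> complex \<Rightarrow> complex ^ 'd \<Rightarrow> (int ^ 'd \<Rightarrow> complex)" where
  "toric_map P s \<theta> = (\<lambda>a\<in>lattice_points P. s * (\<Prod>i\<in>UNIV. \<theta> $ i powi design_matrix i a))"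

definition toric_variety :: "(real ^ 'd::finite) set \<Rightarrow> (int ^ 'd \<Rightarrow> complex) set" where
  "toric_variety P = zariski_closure (lattice_points P)
     {toric_map P s \<theta> | s \<theta>. s \<noteq> 0 \<and> (\<forall>i. \<theta> $ i \<noteq> 0)}"

definition polytope_degree :: "(real ^ 'd::finite) set \<Rightarrow> real" where
  "polytope_degree P = cone_degree (lattice_points P) (toric_variety P)"

definition score_solutions ::
    "(real ^ 'd::finite) set \<Rightarrow> (int ^ 'd \<Rightarrow> nat) \<Rightarrow> (int ^ 'd \<Rightarrow> complex) set" where
  "score_solutions P u = {p \<in> toric_variety P.
     (\<forall>a\<in>lattice_points P. p a \<noteq> 0) \<and>
     (\<forall>r. (\<Sum>a\<in>lattice_points P. of_int (extended_design_matrix r a) * p a) =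
          1 / of_nat (\<Sum>a\<in>lattice_points P. u a) *
          (\<Sum>a\<in>lattice_points P. of_int (extended_design_matrix r a) * of_nat (u a)))}"

text \<open>
  A property holds for generic data if it holds for all data vectors of natural numbers outside
  the zero set of some nonzero polynomial.  (The zero vector, for which the right-hand side of the
  score equations is meaningless, can always be excluded this way.)
\<close>

definition generic_data :: "'i set \<Rightarrow> (('i \<Rightarrow> nat) \<Rightarrow> bool) \<Rightarrow> bool" where
  "generic_data I Q \<longleftrightarrow> (\<exists>g\<in>cpolys I. g \<noteq> 0 \<and>
     (\<forall>u\<in>I \<rightarrow>\<^sub>E UNIV. cpoly_eval (\<lambda>i. of_nat (u i)) g \<noteq> 0 \<longrightarrow> Q u))"

definition mldeg :: "(real ^ 'd::finite) set \<Rightarrow> nat" where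
  "mldeg P = (THE N. generic_data (lattice_points P)
     (\<lambda>u. finite (score_solutions P u) \<and> card (score_solutions P u) = N))"

definition cube :: "(real ^ 'd::finite) set" where
  "cube = {x. \<forall>i. x $ i \<in> {-1..1}}"

end

theory Submission
  imports Defs
begin

text \<open>
  Let \<open>d = CARD('d)\<close>. The degree of the cube is \<open>d! * 2 ^ d\<close>, its ML degree is only \<open>2 ^ d\<close>, and
  \<open>d! > 1\<close> for \<open>d > 1\<close>.

  For the degree, the Hilbert function of a toric variety at \<open>k\<close> counts the sums of \<open>k\<close> lattice points
  of the polytope (\<open>hilbert_function_toric_variety\<close>): the ideal is spanned by binomials, so two
  monomials become equal in the coordinate ring exactly when they parametrize to the same Laurent
  monomial. For the cube these sums are all the lattice points of the cube scaled by \<open>k\<close>, of which there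
  are \<open>(2 * k + 1) ^ d\<close>. This polynomial in \<open>k\<close> has degree \<open>d\<close> and leading coefficient \<open>2 ^ d\<close>.

  For the ML degree, a point of the variety without zero coordinates comes from unique parameters \<open>s\<close>
  and \<open>\<theta>\<close> in the torus (\<open>cube_variety_torus_point\<close>). The sum of its coordinates is the product of \<open>s\<close> and
  the factors \<open>inverse \<theta>\<^sub>i + 1 + \<theta>\<^sub>i\<close>, since the cube is a product of segments. In statistical
  terms, the model consists of independent variables, and the score equations decouple into one
  quadratic equation for each \<open>\<theta>\<^sub>i\<close> (\<open>score_solutions_cube\<close>). If the lattice point \<open>0\<close> has been observed,
  every quadratic has two distinct nonzero roots, which gives \<open>2 ^ d\<close> solutions. A general system with
  these exponents would have as many solutions as the degree, by Kushnirenko's theorem; the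
  coefficients of the product are too special for that.

  Both the vanishing of Laurent polynomials and the uniqueness of the generic count are reduced to
  univariate polynomials by restriction to monomial curves with separating weights.
\<close>

section \<open>Monomials and evaluation\<close>

definition monom_eval :: "('i \<Rightarrow> complex) \<Rightarrow> 'i monom \<Rightarrow> complex" where
  "monom_eval p m = (\<Prod>i\<in>Poly_Mapping.keys m. p i ^ Poly_Mapping.lookup m i)"

definition total_degree :: "'i monom \<Rightarrow> nat" where
  "total_degree m = (\<Sum>i\<in>Poly_Mapping.keys m. Poly_Mapping.lookup m i)"

text \<open>
  The vector \<open>A m\<close>: under the toric parametrization the monomial \<open>x\<^sup>m\<close> pulls back to
  \<open>s\<close> to the power \<open>total_degree m\<close>, times \<open>\<theta>\<close> to the power \<open>lattice_weight m\<close>.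
\<close>

definition lattice_weight :: "(int ^ 'd) monom \<Rightarrow> int ^ 'd" where
  "lattice_weight m = (\<chi> i. \<Sum>a\<in>Poly_Mapping.keys m. int (Poly_Mapping.lookup m a) * a $ i)"

definition monomials :: "'i set \<Rightarrow> nat \<Rightarrow> 'i monom set" where
  "monomials I k = {m. Poly_Mapping.keys m \<subseteq> I \<and> total_degree m = k}"

text \<open>
  Sums and products over the support of a monomial are awkward when monomials are added, since the
  support varies. Over a common finite superset the exponents simply add, and this gives
  multiplicativity of the evaluation and additivity of the degree and the weight.
\<close>

lemma monom_eval_superset:
  assumes "finite J" "Poly_Mapping.keys m \<subseteq> J"
  shows "monom_eval p m = (\<Prod>i\<in>J. p i ^ Poly_Mapping.lookup m i)"
  unfolding monom_eval_def
  by (rule prod.mono_neutral_left) (use assms in \<open>auto simp: in_keys_iff\<close>)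

lemma total_degree_superset:
  assumes "finite J" "Poly_Mapping.keys m \<subseteq> J"
  shows "total_degree m = (\<Sum>i\<in>J. Poly_Mapping.lookup m i)"
  unfolding total_degree_def
  by (rule sum.mono_neutral_left) (use assms in \<open>auto simp: in_keys_iff\<close>)

lemma lattice_weight_superset:
  assumes "finite J" "Poly_Mapping.keys m \<subseteq> J"
  shows "lattice_weight m $ i = (\<Sum>a\<in>J. int (Poly_Mapping.lookup m a) * a $ i)"
  unfolding lattice_weight_def vec_lambda_beta
  by (rule sum.mono_neutral_left) (use assms in \<open>auto simp: in_keys_iff\<close>)

lemma monom_eval_add: "monom_eval p (m + n) = monom_eval p m * monom_eval p n"
proof -
  let ?J = "Poly_Mapping.keys m \<union> Poly_Mapping.keys n"
  have "Poly_Mapping.keys (m + n) \<subseteq> ?J" by (rule Poly_Mapping.keys_add)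
  then show ?thesis
    by (simp add: monom_eval_superset[of ?J] lookup_add power_add prod.distrib)
qed

lemma total_degree_add: "total_degree (m + n) = total_degree m + total_degree n"
proof -
  let ?J = "Poly_Mapping.keys m \<union> Poly_Mapping.keys n"
  have "Poly_Mapping.keys (m + n) \<subseteq> ?J" by (rule Poly_Mapping.keys_add)
  then show ?thesis
    by (simp add: total_degree_superset[of ?J] lookup_add sum.distrib)
qed

lemma lattice_weight_add: "lattice_weight (m + n) = lattice_weight m + lattice_weight n"
proof -
  let ?J = "Poly_Mapping.keys m \<union> Poly_Mapping.keys n"
  have "Poly_Mapping.keys (m + n) \<subseteq> ?J" by (rule Poly_Mapping.keys_add)
  then show ?thesis
    by (simp add: vec_eq_iff lattice_weight_superset[of ?J] lookup_add sum.distrib distrib_right)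
qed

lemma monom_zero [simp]:
  "monom_eval p 0 = 1" "total_degree 0 = 0" "lattice_weight 0 = 0"
  by (simp_all add: monom_eval_def total_degree_def lattice_weight_def vec_eq_iff)

lemma monom_single [simp]:
  "monom_eval p (Poly_Mapping.single i n) = p i ^ n"
  "total_degree (Poly_Mapping.single i n) = n"
  "lattice_weight (Poly_Mapping.single a (Suc 0)) = a"
  by (simp_all add: monom_eval_def total_degree_def lattice_weight_def vec_eq_iff)

lemma monom_sum:
  "monom_eval p (\<Sum>x\<in>A. f x) = (\<Prod>x\<in>A. monom_eval p (f x))"
  "total_degree (\<Sum>x\<in>A. f x) = (\<Sum>x\<in>A. total_degree (f x))"
  "lattice_weight (\<Sum>x\<in>A. g x) = (\<Sum>x\<in>A. lattice_weight (g x))"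
  by (induction A rule: infinite_finite_induct; simp add: monom_eval_add total_degree_add lattice_weight_add)+

lemma finite_monomials:
  assumes "finite I"
  shows "finite (monomials I k)"
proof (rule finite_imageD)
  have "Poly_Mapping.lookup m i \<le> k" if "m \<in> monomials I k" "i \<in> I" for m i
    using that member_le_sum[of i I "Poly_Mapping.lookup m"] assms total_degree_superset[of I m]
    by (simp add: monomials_def)
  then have "Poly_Mapping.lookup ` monomials I k \<subseteq>
      {f. \<forall>i. (i \<in> I \<longrightarrow> f i \<in> {..k}) \<and> (i \<notin> I \<longrightarrow> f i = 0)}"
    by (auto simp: monomials_def in_keys_iff)
  then show "finite (Poly_Mapping.lookup ` monomials I k)"
    by (rule finite_subset) (intro finite_set_of_finite_funs assms finite_atMost)
  show "inj_on Poly_Mapping.lookup (monomials I k)"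
    by (simp add: inj_on_def)
qed

lemma cpoly_eval_superset:
  assumes "finite M" "Poly_Mapping.keys f \<subseteq> M"
  shows "cpoly_eval p f = (\<Sum>m\<in>M. Poly_Mapping.lookup f m * monom_eval p m)"
  unfolding cpoly_eval_def monom_eval_def
  by (rule sum.mono_neutral_left) (use assms in \<open>auto simp: in_keys_iff\<close>)

lemma cpoly_eval_eq: "cpoly_eval p f = (\<Sum>m\<in>Poly_Mapping.keys f. Poly_Mapping.lookup f m * monom_eval p m)"
  by (rule cpoly_eval_superset) auto

lemma cpoly_eval_single: "cpoly_eval p (Poly_Mapping.single m 1) = monom_eval p m"
  by (simp add: cpoly_eval_eq)

lemma lookup_cpoly_scale:
  "Poly_Mapping.lookup (cpoly_scale c f) m = c * Poly_Mapping.lookup f m"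
  unfolding cpoly_scale_def mult_map_scale_conv_mult[symmetric]
  by (simp add: Poly_Mapping.map.rep_eq when_def)

lemma homogeneous_cpolys_eq:
  "homogeneous_cpolys I k = {f. Poly_Mapping.keys f \<subseteq> monomials I k}"
  by (auto simp: homogeneous_cpolys_def cpolys_def monomials_def total_degree_def)


section \<open>Separating exponent vectors\<close>

text \<open>
  Substituting \<open>x\<^sub>i = t\<close> to the power \<open>w i\<close> turns a polynomial in many variables into one in a single
  variable. For the weights below no two of its terms collide. They are the place values of a
  positional number system: the weight of a new variable exceeds every value that the previous
  variables can contribute, so that division with remainder recovers its exponent. The substitution is
  used twice, to find natural points outside hypersurfaces and to compare coefficients of Laurent
  polynomials on the torus.
\<close>

lemma separating_weights:
  fixes S :: "('i \<Rightarrow> nat) set"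
  assumes "finite I" "finite S"
  shows "\<exists>w::'i \<Rightarrow> nat. \<forall>f\<in>S. \<forall>g\<in>S.
           (\<Sum>i\<in>I. w i * f i) = (\<Sum>i\<in>I. w i * g i) \<longrightarrow> (\<forall>i\<in>I. f i = g i)"
  using assms(1)
proof (induction I)
  case empty
  show ?case by simp
next
  case (insert x I)
  then obtain w :: "'i \<Rightarrow> nat" where w: "\<And>f g. \<lbrakk>f \<in> S; g \<in> S; (\<Sum>i\<in>I. w i * f i) = (\<Sum>i\<in>I. w i * g i)\<rbrakk>
      \<Longrightarrow> \<forall>i\<in>I. f i = g i"
    by blast
  define C where "C = Suc (\<Sum>f\<in>S. \<Sum>i\<in>I. w i * f i)"
  have less: "(\<Sum>i\<in>I. w i * f i) < C" if "f \<in> S" for f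
    using member_le_sum[of f S "\<lambda>f. \<Sum>i\<in>I. w i * f i"] that assms(2) by (simp add: C_def)
  define w' where "w' = w(x := C)"
  have split: "(\<Sum>i\<in>insert x I. w' i * f i) = C * f x + (\<Sum>i\<in>I. w i * f i)" for f :: "'i \<Rightarrow> nat"
  proof -
    have "(\<Sum>i\<in>I. w' i * f i) = (\<Sum>i\<in>I. w i * f i)"
      using insert.hyps by (intro sum.cong) (auto simp: w'_def)
    then show ?thesis using insert.hyps by (simp add: w'_def)
  qed
  have "\<forall>i\<in>insert x I. f i = g i"
    if "f \<in> S" "g \<in> S" and eq: "(\<Sum>i\<in>insert x I. w' i * f i) = (\<Sum>i\<in>insert x I. w' i * g i)" for f g
  proof -
    let ?r = "\<lambda>f. \<Sum>i\<in>I. w i * f i"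
    have *: "C * f x + ?r f = C * g x + ?r g" using eq unfolding split .
    have "(C * f x + ?r f) div C = f x" "(C * g x + ?r g) div C = g x"
      using less[OF that(1)] less[OF that(2)] by simp_all
    with * have "f x = g x" by simp
    moreover from this * have "?r f = ?r g" by simp
    ultimately show ?thesis using w[OF that(1,2)] by simp
  qed
  then show ?case by blast
qed

lemma exponent_fiber_sums_zero:
  fixes c :: "'m \<Rightarrow> complex" and e :: "'m \<Rightarrow> nat"
  assumes "infinite {t. (\<Sum>m\<in>M. c m * t ^ e m) = 0}" "finite M"
  shows "(\<Sum>m | m \<in> M \<and> e m = n. c m) = 0"
proof -
  define q where "q = (\<Sum>m\<in>M. Polynomial.monom (c m) (e m))"
  have "poly q t = (\<Sum>m\<in>M. c m * t ^ e m)" for t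
    by (simp add: q_def poly_sum poly_monom)
  then have "q = 0"
    using assms(1) poly_roots_finite[of q] by auto
  moreover have "coeff q n = (\<Sum>m | m \<in> M \<and> e m = n. c m)"
    using assms(2) by (simp add: q_def coeff_sum sum.inter_filter)
  ultimately show ?thesis by simp
qed

text \<open>
  On the monomial curve with separating weights, \<open>h\<close> becomes a univariate polynomial with the same
  coefficients as \<open>h\<close>, hence a nonzero one.
\<close>

lemma finite_zeros_on_monomial_curve:
  fixes w :: "'i \<Rightarrow> nat"
  assumes "finite I" "h \<in> cpolys I" "h \<noteq> 0"
    and sep: "\<forall>f\<in>S. \<forall>g\<in>S. (\<Sum>i\<in>I. w i * f i) = (\<Sum>i\<in>I. w i * g i) \<longrightarrow> (\<forall>i\<in>I. f i = g i)"
    and S: "Poly_Mapping.lookup ` Poly_Mapping.keys h \<subseteq> S"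
  shows "finite {t. cpoly_eval (\<lambda>i\<in>I. t ^ w i) h = 0}"
proof (rule ccontr)
  assume inf: "infinite {t. cpoly_eval (\<lambda>i\<in>I. t ^ w i) h = 0}"
  define e where "e m = (\<Sum>i\<in>I. w i * Poly_Mapping.lookup m i)" for m :: "'i monom"
  have keys: "Poly_Mapping.keys m \<subseteq> I" if "m \<in> Poly_Mapping.keys h" for m
    using that assms(2) by (simp add: cpolys_def)
  have "monom_eval (\<lambda>i\<in>I. t ^ w i) m = t ^ e m" if "m \<in> Poly_Mapping.keys h" for t m
    using keys[OF that] assms(1)
    by (simp add: monom_eval_superset[of I] e_def power_sum power_mult)
  then have eval: "cpoly_eval (\<lambda>i\<in>I. t ^ w i) h
      = (\<Sum>m\<in>Poly_Mapping.keys h. Poly_Mapping.lookup h m * t ^ e m)" for t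
    by (simp add: cpoly_eval_eq)
  obtain m0 where m0: "m0 \<in> Poly_Mapping.keys h"
    using assms(3) keys_eq_empty by blast
  have "m = m0" if "m \<in> Poly_Mapping.keys h" "e m = e m0" for m
  proof (rule poly_mapping_eqI)
    fix i
    show "Poly_Mapping.lookup m i = Poly_Mapping.lookup m0 i"
    proof (cases "i \<in> I")
      case True
      then show ?thesis using sep S that m0 by (auto simp: e_def)
    next
      case False
      then have "i \<notin> Poly_Mapping.keys m" "i \<notin> Poly_Mapping.keys m0"
        using keys that(1) m0 by auto
      then show ?thesis by (simp add: in_keys_iff)
    qed
  qed
  then have "{m. m \<in> Poly_Mapping.keys h \<and> e m = e m0} = {m0}"
    using m0 by auto
  moreover have "(\<Sum>m | m \<in> Poly_Mapping.keys h \<and> e m = e m0. Poly_Mapping.lookup h m) = 0"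
    by (rule exponent_fiber_sums_zero) (use inf in \<open>simp_all add: eval\<close>)
  ultimately show False
    using m0 by (simp add: in_keys_iff)
qed

text \<open>
  One weight vector can separate the monomials of both polynomials at once. Each then has only finitely
  many zeros on the same monomial curve, and some natural parameter avoids them all.
\<close>

lemma common_nonzero_nat_point:
  fixes f g :: "'i cpoly"
  assumes "finite I" "f \<in> cpolys I" "f \<noteq> 0" "g \<in> cpolys I" "g \<noteq> 0"
  shows "\<exists>u\<in>I \<rightarrow>\<^sub>E (UNIV :: nat set). cpoly_eval (\<lambda>i. of_nat (u i)) f \<noteq> 0 \<and>
           cpoly_eval (\<lambda>i. of_nat (u i)) g \<noteq> 0"
proof -
  define S where "S = Poly_Mapping.lookup ` (Poly_Mapping.keys f \<union> Poly_Mapping.keys g)"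
  have "finite S" by (simp add: S_def)
  then obtain w :: "'i \<Rightarrow> nat" where w: "\<forall>f\<in>S. \<forall>g\<in>S.
      (\<Sum>i\<in>I. w i * f i) = (\<Sum>i\<in>I. w i * g i) \<longrightarrow> (\<forall>i\<in>I. f i = g i)"
    using separating_weights[OF assms(1)] by blast
  let ?Z = "\<lambda>h. {t. cpoly_eval (\<lambda>i\<in>I. t ^ w i) h = 0}"
  have "finite (?Z f \<union> ?Z g)"
    using finite_zeros_on_monomial_curve[OF assms(1) _ _ w, of f]
      finite_zeros_on_monomial_curve[OF assms(1) _ _ w, of g] assms
    by (auto simp: S_def)
  moreover have "infinite (range (of_nat :: nat \<Rightarrow> complex))"
    using range_inj_infinite[OF inj_of_nat] .
  ultimately have "\<not> range (of_nat :: nat \<Rightarrow> complex) \<subseteq> ?Z f \<union> ?Z g"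
    using finite_subset by blast
  then obtain n :: nat where n: "of_nat n \<notin> ?Z f \<union> ?Z g"
    by blast
  define u where "u = (\<lambda>i\<in>I. n ^ w i)"
  have cong: "cpoly_eval (\<lambda>i. of_nat (u i)) h = cpoly_eval (\<lambda>i\<in>I. of_nat n ^ w i) h"
    if "h \<in> cpolys I" for h
  proof -
    have "monom_eval (\<lambda>i. of_nat (u i)) m = monom_eval (\<lambda>i\<in>I. of_nat n ^ w i) m"
      if "m \<in> Poly_Mapping.keys h" for m
    proof -
      have "Poly_Mapping.keys m \<subseteq> I" using that \<open>h \<in> cpolys I\<close> by (simp add: cpolys_def)
      then show ?thesis
        unfolding monom_eval_def by (intro prod.cong) (auto simp: u_def)
    qed
    then show ?thesis by (simp add: cpoly_eval_eq)
  qed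
  show ?thesis
    by (rule bexI[of _ u]) (use n cong assms in \<open>auto simp: u_def\<close>)
qed

text \<open>
  Generic properties hold simultaneously for some data. Hence a generic number of solutions is unique,
  which is what makes the definite description in the ML degree meaningful.
\<close>

lemma generic_data_compatible:
  assumes "finite I" "generic_data I P" "generic_data I Q"
  shows "\<exists>u. P u \<and> Q u"
  using assms common_nonzero_nat_point[OF assms(1)] unfolding generic_data_def by metis


section \<open>The Hilbert function of a toric variety\<close>

text \<open>
  Polynomials are independent as soon as each of them owns a monomial that has coefficient 1 in it and
  does not occur in the others.
\<close>

lemma independent_if_dual:
  assumes "finite N"
    and dual: "\<And>m n. m \<in> N \<Longrightarrow> n \<in> N \<Longrightarrow> Poly_Mapping.lookup (b m) n = (if m = n then 1 else 0)"
  shows "inj_on b N" "cpoly.independent (b ` N)"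
proof -
  show inj: "inj_on b N"
  proof (rule inj_onI)
    fix m n assume *: "m \<in> N" "n \<in> N" "b m = b n"
    show "m = n" using dual[OF *(1) *(2)] dual[OF *(2) *(2)] *(3) by (auto split: if_splits)
  qed
  show "cpoly.independent (b ` N)"
  proof
    assume "cpoly.dependent (b ` N)"
    then obtain u n where n: "n \<in> N" "u (b n) \<noteq> 0"
        and zero: "(\<Sum>v\<in>b ` N. cpoly_scale (u v) v) = 0"
      using cpoly.dependent_finite[of "b ` N"] assms(1) by auto
    have "0 = Poly_Mapping.lookup (\<Sum>m\<in>N. cpoly_scale (u (b m)) (b m)) n"
      using zero by (simp add: sum.reindex[OF inj])
    also have "\<dots> = (\<Sum>m\<in>N. if m = n then u (b m) else 0)"
      by (auto simp: lookup_sum lookup_cpoly_scale dual n intro!: sum.cong)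
    also have "\<dots> = u (b n)" using n assms(1) by simp
    finally show False using n by simp
  qed
qed

lemma dim_monomial_span:
  assumes "finite M"
  shows "cpoly.dim {f :: 'i cpoly. Poly_Mapping.keys f \<subseteq> M} = card M"
proof -
  define b :: "'i monom \<Rightarrow> 'i cpoly" where "b m = Poly_Mapping.single m 1" for m
  have dual: "Poly_Mapping.lookup (b m) n = (if m = n then 1 else 0)" for m n
    by (simp add: b_def lookup_single when_def)
  note ind = independent_if_dual[OF assms, of b, OF dual]
  show ?thesis
  proof (rule cpoly.dim_unique[of "b ` M"])
    show "b ` M \<subseteq> {f. Poly_Mapping.keys f \<subseteq> M}" by (auto simp: b_def)
    show "{f. Poly_Mapping.keys f \<subseteq> M} \<subseteq> cpoly.span (b ` M)"
    proof safe
      fix f :: "'i cpoly" assume f: "Poly_Mapping.keys f \<subseteq> M"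
      have "f = (\<Sum>m\<in>M. cpoly_scale (Poly_Mapping.lookup f m) (b m))"
      proof (rule poly_mapping_eqI)
        fix n
        have "Poly_Mapping.lookup (\<Sum>m\<in>M. cpoly_scale (Poly_Mapping.lookup f m) (b m)) n =
            (\<Sum>m\<in>M. if m = n then Poly_Mapping.lookup f m else 0)"
          by (auto simp: lookup_sum lookup_cpoly_scale dual intro!: sum.cong)
        also have "\<dots> = Poly_Mapping.lookup f n"
          using assms f by (auto simp: in_keys_iff)
        finally show "Poly_Mapping.lookup f n = Poly_Mapping.lookup
          (\<Sum>m\<in>M. cpoly_scale (Poly_Mapping.lookup f m) (b m)) n" by simp
      qed
      also have "\<dots> \<in> cpoly.span (b ` M)"
        by (intro cpoly.span_sum cpoly.span_scale cpoly.span_base imageI)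
      finally show "f \<in> cpoly.span (b ` M)" .
    qed
    show "card (b ` M) = card M" by (rule card_image) (rule ind)
  qed (rule ind)
qed

text \<open>
  The vanishing conditions on the coefficients amount to one linear equation for each fibre of
  \<open>\<phi>\<close>, and these equations have disjoint
  supports. A basis of the solution space is obtained by choosing a representative monomial
  \<open>r m\<close> in the fibre of every \<open>m\<close> and taking the binomials that subtract \<open>r m\<close> from \<open>m\<close>, one for every
  monomial that is not a representative. There are as many representatives as fibres.
\<close>

lemma dim_fiber_sums_zero:
  fixes \<phi> :: "'i monom \<Rightarrow> 'b"
  assumes "finite M"
  shows "cpoly.dim {f. Poly_Mapping.keys f \<subseteq> M \<and>
           (\<forall>\<beta>. (\<Sum>m | m \<in> M \<and> \<phi> m = \<beta>. Poly_Mapping.lookup f m) = 0)} = card M - card (\<phi> ` M)"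
    (is "cpoly.dim ?K = _")
proof -
  define r where "r m = inv_into M \<phi> (\<phi> m)" for m
  have rM: "r m \<in> M" if "m \<in> M" for m
    using that by (simp add: r_def inv_into_into)
  have \<phi>r: "\<phi> (r m) = \<phi> m" if "m \<in> M" for m
    using that by (simp add: r_def f_inv_into_f)
  have r_eq: "r m = r n" if "\<phi> m = \<phi> n" for m n
    using that by (simp add: r_def)
  define N where "N = M - r ` M"
  have N: "N \<subseteq> M" "finite N" using assms by (auto simp: N_def)
  have r_notin: "r m \<notin> N" if "m \<in> M" for m
    using that by (simp add: N_def)
  define b where "b m = Poly_Mapping.single m 1 - Poly_Mapping.single (r m) (1::complex)" for m
  have lookup_b: "Poly_Mapping.lookup (b m) n = (if m = n then 1 else 0) - (if r m = n then 1 else 0)"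
    for m n by (simp add: b_def lookup_minus lookup_single when_def)
  have dual: "Poly_Mapping.lookup (b m) n = (if m = n then 1 else 0)" if "m \<in> N" "n \<in> N" for m n
    using r_notin[of m] that N(1) by (auto simp: lookup_b)
  note ind = independent_if_dual[OF N(2), of b, OF dual]
  have "card (r ` M) = card (inv_into M \<phi> ` \<phi> ` M)"
    by (simp add: r_def image_image)
  also have "\<dots> = card (\<phi> ` M)"
    by (intro card_image inj_on_inv_into) auto
  finally have cardN: "card N = card M - card (\<phi> ` M)"
    using assms rM by (simp add: N_def card_Diff_subset image_subset_iff)
  show ?thesis
  proof (rule cpoly.dim_unique[of "b ` N"])
    have "b m \<in> ?K" if "m \<in> N" for m
    proof -
      have m: "m \<in> M" "r m \<in> M" "\<phi> (r m) = \<phi> m" using that N rM \<phi>r by auto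
      have "Poly_Mapping.keys (b m) \<subseteq> M"
        using keys_diff[of "Poly_Mapping.single m (1::complex)" "Poly_Mapping.single (r m) 1"] m
        by (auto simp: b_def)
      moreover have "(\<Sum>n | n \<in> M \<and> \<phi> n = \<beta>. Poly_Mapping.lookup (b m) n) = 0" for \<beta>
        using m assms by (simp add: lookup_b sum_subtractf)
      ultimately show ?thesis by simp
    qed
    then show "b ` N \<subseteq> ?K" by blast
    show "?K \<subseteq> cpoly.span (b ` N)"
    proof
      fix f assume "f \<in> ?K"
      then have f: "Poly_Mapping.keys f \<subseteq> M"
        and fib: "\<And>\<beta>. (\<Sum>m | m \<in> M \<and> \<phi> m = \<beta>. Poly_Mapping.lookup f m) = 0"
        by auto
      have "f = (\<Sum>m\<in>N. cpoly_scale (Poly_Mapping.lookup f m) (b m))"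
      proof (rule poly_mapping_eqI)
        fix n
        have "Poly_Mapping.lookup (\<Sum>m\<in>N. cpoly_scale (Poly_Mapping.lookup f m) (b m)) n
            = (\<Sum>m\<in>N. (if m = n then Poly_Mapping.lookup f m else 0)
                   - (if r m = n then Poly_Mapping.lookup f m else 0))"
          by (auto simp: lookup_sum lookup_cpoly_scale lookup_b intro!: sum.cong)
        also have "\<dots> = (if n \<in> N then Poly_Mapping.lookup f n else 0)
            - (\<Sum>m | m \<in> N \<and> r m = n. Poly_Mapping.lookup f m)"
          using N(2) by (simp add: sum_subtractf sum.inter_filter)
        also have "\<dots> = Poly_Mapping.lookup f n"
        \<comment> \<open>A representative occurs in the binomials of all other members of its fibre; its coefficient in
          \<open>f\<close> comes out right because the coefficients of \<open>f\<close> sum to zero over the fibre.\<close>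
        proof (cases "n \<in> r ` M")
          case True
          then obtain n' where n': "n' \<in> M" "n = r n'" by blast
          then have n: "n \<in> M" "\<phi> n = \<phi> n'" "n \<notin> N" using rM \<phi>r r_notin by auto
          have rn: "r n = n" using r_eq[OF n(2)] n' by simp
          have "m = n" if m: "m \<in> M" "\<phi> m = \<phi> n" and notin: "\<not> (m \<in> N \<and> r m = n)" for m
          proof -
            have "r m = n" using r_eq[OF m(2)] rn by simp
            with notin m have "m \<in> r ` M" by (auto simp: N_def)
            then obtain m' where m': "m' \<in> M" "m = r m'" by blast
            then have "r m = m" using r_eq[of m m'] \<phi>r by simp
            with \<open>r m = n\<close> show "m = n" by simp
          qed
          then have "{m. m \<in> M \<and> \<phi> m = \<phi> n} = insert n {m. m \<in> N \<and> r m = n}"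
            using n N(1) \<phi>r by auto
          with fib[of "\<phi> n"] have "Poly_Mapping.lookup f n + (\<Sum>m | m \<in> N \<and> r m = n. Poly_Mapping.lookup f m) = 0"
            using N(2) n(3) by simp
          then show ?thesis using n(3) by (simp add: add_eq_0_iff)
        next
          case False
          then have "(\<Sum>m | m \<in> N \<and> r m = n. Poly_Mapping.lookup f m) = 0"
            using N(1) by (intro sum.neutral) auto
          moreover have "Poly_Mapping.lookup f n = 0" if "n \<notin> N"
          proof -
            have "n \<notin> M" using that False by (simp add: N_def)
            then show ?thesis using f by (auto simp: in_keys_iff)
          qed
          ultimately show ?thesis by simp
        qed
        finally show "Poly_Mapping.lookup f n = Poly_Mapping.lookup
          (\<Sum>m\<in>N. cpoly_scale (Poly_Mapping.lookup f m) (b m)) n" by simp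
      qed
      also have "\<dots> \<in> cpoly.span (b ` N)"
        by (intro cpoly.span_sum cpoly.span_scale cpoly.span_base imageI)
      finally show "f \<in> cpoly.span (b ` N)" .
    qed
    show "card (b ` N) = card M - card (\<phi> ` M)"
      using card_image[OF ind(1)] cardN by simp
  qed (rule ind)
qed

definition torus_image :: "(real ^ 'd::finite) set \<Rightarrow> (int ^ 'd \<Rightarrow> complex) set" where
  "torus_image P = {toric_map P s \<theta> | s \<theta>. s \<noteq> 0 \<and> (\<forall>i. \<theta> $ i \<noteq> 0)}"

text \<open>
  Passing to the closure does not change the ideal, so the equations of the toric variety can be read
  off from its torus points alone.
\<close>

lemma vanishing_ideal_zariski_closure:
  assumes "S \<subseteq> I \<rightarrow>\<^sub>E UNIV"
  shows "vanishing_ideal I (zariski_closure I S) = vanishing_ideal I S"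
  using assms by (auto simp: vanishing_ideal_def zariski_closure_def)

lemma zariski_closure_superset:
  assumes "S \<subseteq> I \<rightarrow>\<^sub>E UNIV"
  shows "S \<subseteq> zariski_closure I S"
  using assms by (auto simp: vanishing_ideal_def zariski_closure_def)

lemma torus_image_subset_PiE: "torus_image P \<subseteq> lattice_points P \<rightarrow>\<^sub>E UNIV"
  by (auto simp: torus_image_def toric_map_def)

lemma prod_powi:
  fixes x :: complex
  assumes "x \<noteq> 0"
  shows "(\<Prod>a\<in>A. x powi f a) = x powi (\<Sum>a\<in>A. f a)"
  by (induction A rule: infinite_finite_induct) (simp_all add: power_int_add assms)

lemma monom_eval_toric_map:
  assumes "Poly_Mapping.keys m \<subseteq> lattice_points P" "\<And>i. \<theta> $ i \<noteq> 0"
  shows "monom_eval (toric_map P s \<theta>) m =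
    s ^ total_degree m * (\<Prod>i\<in>UNIV. \<theta> $ i powi (lattice_weight m $ i))"
proof -
  let ?K = "Poly_Mapping.keys m" and ?l = "Poly_Mapping.lookup m"
  have "monom_eval (toric_map P s \<theta>) m = (\<Prod>a\<in>?K. (s * (\<Prod>i\<in>UNIV. \<theta> $ i powi (a $ i))) ^ ?l a)"
    unfolding monom_eval_def
    by (intro prod.cong) (use assms in \<open>auto simp: toric_map_def design_matrix_def\<close>)
  also have "\<dots> = (\<Prod>a\<in>?K. s ^ ?l a) * (\<Prod>a\<in>?K. \<Prod>i\<in>UNIV. \<theta> $ i powi (int (?l a) * a $ i))"
    by (simp add: power_mult_distrib prod.distrib prod_power_distrib power_int_power' mult.commute)
  also have "(\<Prod>a\<in>?K. s ^ ?l a) = s ^ total_degree m"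
    by (simp add: total_degree_def power_sum)
  also have "(\<Prod>a\<in>?K. \<Prod>i\<in>UNIV. \<theta> $ i powi (int (?l a) * a $ i)) =
      (\<Prod>i\<in>UNIV. \<Prod>a\<in>?K. \<theta> $ i powi (int (?l a) * a $ i))"
    by (rule prod.swap)
  also have "\<dots> = (\<Prod>i\<in>UNIV. \<theta> $ i powi (lattice_weight m $ i))"
    using assms(2) by (simp add: prod_powi lattice_weight_def)
  finally show ?thesis .
qed

text \<open>
  Pulled back to the torus, a form of degree \<open>k\<close> becomes \<open>s\<close> to the power \<open>k\<close> times a Laurent polynomial in
  \<open>\<theta>\<close>, whose coefficient at \<open>\<beta>\<close> collects the coefficients of all monomials of weight \<open>\<beta>\<close>. A Laurent
  polynomial that vanishes on the torus is zero; this is seen by restricting it to a monomial curve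
  whose weights separate the exponents.
\<close>

lemma vanishing_on_torus_iff:
  fixes P :: "(real ^ 'd::finite) set"
  assumes "finite (lattice_points P)" "Poly_Mapping.keys f \<subseteq> monomials (lattice_points P) k"
  shows "(\<forall>p\<in>torus_image P. cpoly_eval p f = 0) \<longleftrightarrow>
    (\<forall>\<beta>. (\<Sum>m | m \<in> monomials (lattice_points P) k \<and> lattice_weight m = \<beta>. Poly_Mapping.lookup f m) = 0)"
    (is "?L \<longleftrightarrow> (\<forall>\<beta>. ?c \<beta> = 0)")
proof -
  let ?M = "monomials (lattice_points P) k"
  have fin: "finite ?M" by (rule finite_monomials[OF assms(1)])
  have eval: "cpoly_eval (toric_map P s \<theta>) f = s ^ k *
      (\<Sum>m\<in>?M. Poly_Mapping.lookup f m * (\<Prod>i\<in>UNIV. \<theta> $ i powi (lattice_weight m $ i)))"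
    if "\<And>i. \<theta> $ i \<noteq> 0" for s \<theta>
    unfolding cpoly_eval_superset[OF fin assms(2)] sum_distrib_left
  proof (intro sum.cong refl)
    fix m assume "m \<in> ?M"
    then show "Poly_Mapping.lookup f m * monom_eval (toric_map P s \<theta>) m =
        s ^ k * (Poly_Mapping.lookup f m * (\<Prod>i\<in>UNIV. \<theta> $ i powi (lattice_weight m $ i)))"
      using monom_eval_toric_map[of m P \<theta> s] that by (simp add: monomials_def)
  qed
  show ?thesis
  proof
    assume c: "\<forall>\<beta>. ?c \<beta> = 0"
    show ?L
    proof
      fix p assume "p \<in> torus_image P"
      then obtain s \<theta> where p: "p = toric_map P s \<theta>" and \<theta>: "\<And>i. \<theta> $ i \<noteq> 0"
        by (auto simp: torus_image_def)
      let ?x = "\<lambda>\<beta>. \<Prod>i\<in>UNIV. \<theta> $ i powi (\<beta> $ i)"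
      have "(\<Sum>m\<in>?M. Poly_Mapping.lookup f m * ?x (lattice_weight m)) =
        (\<Sum>\<beta>\<in>lattice_weight ` ?M. \<Sum>m | m \<in> ?M \<and> lattice_weight m = \<beta>.
            Poly_Mapping.lookup f m * ?x (lattice_weight m))"
        by (rule sum.image_gen[OF fin])
      also have "\<dots> = (\<Sum>\<beta>\<in>lattice_weight ` ?M. ?c \<beta> * ?x \<beta>)"
        by (simp add: sum_distrib_right)
      also have "\<dots> = 0" using c by simp
      finally show "cpoly_eval p f = 0" by (simp add: p eval \<theta>)
    qed
  next
    assume van: ?L
    \<comment> \<open>Adding \<open>C\<close> to every exponent makes all exponents natural numbers, so that an ordinary
      polynomial in \<open>t\<close> arises.\<close>
    define C where "C = (\<Sum>m\<in>?M. \<Sum>i\<in>UNIV. \<bar>lattice_weight m $ i\<bar>)"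
    have C: "0 \<le> lattice_weight m $ i + C" if "m \<in> ?M" for m i
    proof -
      have "\<bar>lattice_weight m $ i\<bar> \<le> (\<Sum>i\<in>UNIV. \<bar>lattice_weight m $ i\<bar>)"
        by (rule member_le_sum) auto
      also have "\<dots> \<le> C"
        unfolding C_def using that fin
        by (intro member_le_sum[of m ?M "\<lambda>m. \<Sum>i\<in>UNIV. \<bar>lattice_weight m $ i\<bar>"] sum_nonneg) auto
      finally show ?thesis by linarith
    qed
    define \<nu> where "\<nu> m = (\<lambda>i. nat (lattice_weight m $ i + C))" for m :: "(int ^ 'd) monom"
    have "finite (\<nu> ` ?M)" using fin by simp
    from separating_weights[OF finite_class.finite_UNIV this]
    obtain w :: "'d \<Rightarrow> nat" where w: "\<forall>f\<in>\<nu> ` ?M. \<forall>g\<in>\<nu> ` ?M.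
        (\<Sum>i\<in>UNIV. w i * f i) = (\<Sum>i\<in>UNIV. w i * g i) \<longrightarrow> (\<forall>i\<in>UNIV. f i = g i)"
      ..
    define e where "e m = (\<Sum>i\<in>UNIV. w i * \<nu> m i)" for m
    have e_iff: "e m = e n \<longleftrightarrow> lattice_weight m = lattice_weight n" if "m \<in> ?M" "n \<in> ?M" for m n
    proof
      assume "e m = e n"
      then have "\<forall>i\<in>UNIV. \<nu> m i = \<nu> n i"
        using w that unfolding e_def by blast
      then show "lattice_weight m = lattice_weight n"
        using C that by (simp add: \<nu>_def vec_eq_iff eq_nat_nat_iff)
    qed (simp add: e_def \<nu>_def)
    have "(\<Sum>m\<in>?M. Poly_Mapping.lookup f m * t ^ e m) = 0" if t: "t \<noteq> 0" for t
    proof -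
      define \<theta> where "\<theta> = (\<chi> i. t ^ w i)"
      have \<theta>: "\<theta> $ i \<noteq> 0" for i using t by (simp add: \<theta>_def)
      have pow: "t ^ e m = (\<Prod>i\<in>UNIV. t powi (int (w i) * C)) * (\<Prod>i\<in>UNIV. \<theta> $ i powi (lattice_weight m $ i))"
        if "m \<in> ?M" for m
      proof -
        have "t ^ e m = (\<Prod>i\<in>UNIV. t powi (int (w i) * (lattice_weight m $ i + C)))"
          unfolding e_def power_sum
        proof (intro prod.cong refl)
          fix i
          have "t ^ (w i * \<nu> m i) = t powi (int (w i * \<nu> m i))"
            by (simp only: power_int_of_nat)
          also have "int (w i * \<nu> m i) = int (w i) * (lattice_weight m $ i + C)"
            using C[OF that, of i] by (simp add: \<nu>_def)
          finally show "t ^ (w i * \<nu> m i) = t powi (int (w i) * (lattice_weight m $ i + C))" .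
        qed
        also have "\<dots> = (\<Prod>i\<in>UNIV. t powi (int (w i) * C)) * (\<Prod>i\<in>UNIV. \<theta> $ i powi (lattice_weight m $ i))"
          unfolding prod.distrib[symmetric]
          by (intro prod.cong refl) (simp add: \<theta>_def t power_int_power distrib_left power_int_add)
        finally show ?thesis .
      qed
      have "toric_map P 1 \<theta> \<in> torus_image P"
        unfolding torus_image_def using \<theta> by (intro CollectI exI[of _ 1] exI[of _ \<theta>]) simp
      then have "(\<Sum>m\<in>?M. Poly_Mapping.lookup f m * (\<Prod>i\<in>UNIV. \<theta> $ i powi (lattice_weight m $ i))) = 0"
        using van eval[OF \<theta>, of 1] by simp
      then have "(\<Prod>i\<in>UNIV. t powi (int (w i) * C)) *
        (\<Sum>m\<in>?M. Poly_Mapping.lookup f m * (\<Prod>i\<in>UNIV. \<theta> $ i powi (lattice_weight m $ i))) = 0"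
        by simp
      then show ?thesis
        unfolding sum_distrib_left by (simp add: pow mult.left_commute cong: sum.cong)
    qed
    then have "- {0} \<subseteq> {t. (\<Sum>m\<in>?M. Poly_Mapping.lookup f m * t ^ e m) = 0}" by blast
    moreover have "infinite (- {0 :: complex})"
      using infinite_UNIV_char_0 by (simp add: Compl_eq_Diff_UNIV)
    ultimately have inf: "infinite {t. (\<Sum>m\<in>?M. Poly_Mapping.lookup f m * t ^ e m) = 0}"
      by (rule infinite_super)
    show "\<forall>\<beta>. ?c \<beta> = 0"
    proof
      fix \<beta>
      show "?c \<beta> = 0"
      proof (cases "\<beta> \<in> lattice_weight ` ?M")
        case True
        then obtain m0 where m0: "m0 \<in> ?M" "\<beta> = lattice_weight m0" by blast
        then have "{m. m \<in> ?M \<and> lattice_weight m = \<beta>} = {m. m \<in> ?M \<and> e m = e m0}"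
          using e_iff by blast
        then show ?thesis using exponent_fiber_sums_zero[OF inf fin] by simp
      next
        case False
        then show ?thesis by (intro sum.neutral) auto
      qed
    qed
  qed
qed

text \<open>
  The coordinate ring of a toric variety is a semigroup algebra: its degree \<open>k\<close> part has a basis indexed
  by the sums of \<open>k\<close> lattice points of the polytope.
\<close>

theorem hilbert_function_toric_variety:
  fixes P :: "(real ^ 'd::finite) set"
  assumes "finite (lattice_points P)"
  shows "hilbert_function (lattice_points P) (toric_variety P) k =
    card (lattice_weight ` monomials (lattice_points P) k)"
proof -
  let ?M = "monomials (lattice_points P) k"
  have fin: "finite ?M" by (rule finite_monomials[OF assms(1)])
  have van: "vanishing_ideal (lattice_points P) (toric_variety P) =
      vanishing_ideal (lattice_points P) (torus_image P)"
    using vanishing_ideal_zariski_closure[OF torus_image_subset_PiE]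
    by (simp add: toric_variety_def torus_image_def)
  have "homogeneous_cpolys (lattice_points P) k \<inter> vanishing_ideal (lattice_points P) (toric_variety P)
      = {f. Poly_Mapping.keys f \<subseteq> ?M \<and> (\<forall>p\<in>torus_image P. cpoly_eval p f = 0)}"
    unfolding van by (auto simp: homogeneous_cpolys_def cpolys_def monomials_def total_degree_def vanishing_ideal_def)
  also have "\<dots> = {f. Poly_Mapping.keys f \<subseteq> ?M \<and>
      (\<forall>\<beta>. (\<Sum>m | m \<in> ?M \<and> lattice_weight m = \<beta>. Poly_Mapping.lookup f m) = 0)}"
    using vanishing_on_torus_iff[OF assms] by (intro Collect_cong conj_cong refl)
  finally have "cpoly.dim (homogeneous_cpolys (lattice_points P) k \<inter>
      vanishing_ideal (lattice_points P) (toric_variety P)) = card ?M - card (lattice_weight ` ?M)"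
    by (simp only: dim_fiber_sums_zero[OF fin])
  moreover have "cpoly.dim (homogeneous_cpolys (lattice_points P) k) = card ?M"
    unfolding homogeneous_cpolys_eq by (rule dim_monomial_span[OF fin])
  ultimately show ?thesis
    using card_image_le[OF fin, of lattice_weight] by (simp add: hilbert_function_def)
qed


section \<open>The degree of the cube\<close>

lemma bij_betw_vec_lambda_PiE:
  "bij_betw vec_lambda (PiE UNIV A) {v :: 'b ^ 'd::finite. \<forall>i. v $ i \<in> A i}"
  by (rule bij_betw_byWitness[where f' = vec_nth]) auto

lemma finite_card_vec_box:
  fixes A :: "'d::finite \<Rightarrow> 'b set"
  assumes "\<And>i. finite (A i)"
  shows "finite {v :: 'b ^ 'd. \<forall>i. v $ i \<in> A i}"
    and "card {v :: 'b ^ 'd. \<forall>i. v $ i \<in> A i} = (\<Prod>i\<in>UNIV. card (A i))"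
  using bij_betw_finite[OF bij_betw_vec_lambda_PiE[of A]] bij_betw_same_card[OF bij_betw_vec_lambda_PiE[of A]]
  by (simp_all add: finite_PiE assms card_PiE)

lemma lattice_points_cube:
  "lattice_points (cube :: (real ^ 'd::finite) set) = {a. \<forall>i. a $ i \<in> {-1, 0, 1}}"
proof -
  have "real_of_int x \<in> {-1..1} \<longleftrightarrow> x \<in> {-1, 0, 1}" for x by auto
  then show ?thesis by (simp add: lattice_points_def cube_def)
qed

lemma finite_lattice_points_cube: "finite (lattice_points (cube :: (real ^ 'd::finite) set))"
  unfolding lattice_points_cube by (rule finite_card_vec_box) simp

text \<open>
  The cube is normal: every lattice point \<open>\<beta>\<close> of the cube scaled by \<open>k\<close> is a sum of \<open>k\<close> lattice points
  of the cube. The \<open>j\<close>-th summand takes one unit step towards \<open>\<beta>\<close> in each coordinate in which \<open>j\<close> steps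
  do not yet reach \<open>\<beta>\<close>, and stays put in the others.
\<close>

lemma lattice_weights_cube:
  "lattice_weight ` monomials (lattice_points (cube :: (real ^ 'd::finite) set)) k =
     {\<beta>. \<forall>i. \<beta> $ i \<in> {- int k..int k}}" (is "_ ` ?M = ?B")
proof
  show "lattice_weight ` ?M \<subseteq> ?B"
  proof safe
    fix m i assume m: "m \<in> ?M"
    have "\<bar>lattice_weight m $ i\<bar> \<le> (\<Sum>a\<in>Poly_Mapping.keys m. \<bar>int (Poly_Mapping.lookup m a) * a $ i\<bar>)"
      unfolding lattice_weight_def vec_lambda_beta by (rule sum_abs)
    also have "\<dots> \<le> (\<Sum>a\<in>Poly_Mapping.keys m. int (Poly_Mapping.lookup m a))"
    proof (rule sum_mono)
      fix a assume "a \<in> Poly_Mapping.keys m"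
      then have "a $ i \<in> {-1, 0, 1}" using m by (auto simp: monomials_def lattice_points_cube)
      then show "\<bar>int (Poly_Mapping.lookup m a) * a $ i\<bar> \<le> int (Poly_Mapping.lookup m a)" by auto
    qed
    also have "\<dots> = int k"
      using m by (auto simp: monomials_def total_degree_def simp flip: of_nat_sum)
    finally show "lattice_weight m $ i \<in> {- int k..int k}" by auto
  qed
  show "?B \<subseteq> lattice_weight ` ?M"
  proof
    fix \<beta> assume \<beta>: "\<beta> \<in> ?B"
    define a where "a j = (\<chi> i. if j < nat \<bar>\<beta> $ i\<bar> then sgn (\<beta> $ i) else 0)" for j
    define m where "m = (\<Sum>j<k. Poly_Mapping.single (a j) (Suc 0))"
    have "a j \<in> lattice_points cube" for j
      by (auto simp: lattice_points_cube a_def sgn_if)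
    then have "Poly_Mapping.keys m \<subseteq> lattice_points cube"
      using keys_sum[of "\<lambda>j. Poly_Mapping.single (a j) (Suc 0)" "{..<k}"] by (fastforce simp: m_def)
    moreover have "total_degree m = k" by (simp add: m_def monom_sum)
    moreover have "lattice_weight m = \<beta>"
    proof (simp add: vec_eq_iff m_def monom_sum, rule allI)
      fix i
      have "\<beta> $ i \<in> {- int k..int k}" using \<beta> by blast
      then have "nat \<bar>\<beta> $ i\<bar> \<le> k" by auto
      then have "{j. j < k \<and> j < nat \<bar>\<beta> $ i\<bar>} = {..<nat \<bar>\<beta> $ i\<bar>}" by auto
      then show "(\<Sum>j<k. a j $ i) = \<beta> $ i"
        by (simp add: a_def sum.inter_filter[symmetric] abs_mult_sgn)
    qed
    ultimately show "\<beta> \<in> lattice_weight ` ?M" by (force simp: monomials_def)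
  qed
qed

lemma hilbert_function_cube:
  "hilbert_function (lattice_points (cube :: (real ^ 'd::finite) set)) (toric_variety (cube :: (real ^ 'd) set)) k =
     (2 * k + 1) ^ CARD('d)"
  unfolding hilbert_function_toric_variety[OF finite_lattice_points_cube] lattice_weights_cube
  by (subst finite_card_vec_box) (simp_all add: nat_add_distrib nat_mult_distrib)

lemma poly_eqI_eventually:
  fixes p q :: "real poly"
  assumes "\<forall>\<^sub>F k in sequentially. poly p (real k) = poly q (real k)"
  shows "p = q"
proof -
  obtain n where n: "\<And>k. k \<ge> n \<Longrightarrow> poly p (real k) = poly q (real k)"
    using assms by (auto simp: eventually_sequentially)
  have "real ` {n..} \<subseteq> {x. poly (p - q) x = 0}" using n by auto
  moreover have "infinite (real ` {n..})"
    using finite_imageD[of real "{n..}"] infinite_Ici by (auto simp: inj_on_def)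
  ultimately have "p - q = 0"
    using poly_roots_finite[of "p - q"] finite_subset by blast
  then show ?thesis by simp
qed

text \<open>
  The Hilbert function \<open>(2 * k + 1) ^ CARD('d)\<close> is itself a polynomial in \<open>k\<close>.
\<close>

theorem polytope_degree_cube:
  "polytope_degree (cube :: (real ^ 'd::finite) set) = fact CARD('d) * 2 ^ CARD('d)"
proof -
  let ?C = "cube :: (real ^ 'd) set"
  define h :: "real poly" where "h = [:1, 2:] ^ CARD('d)"
  have h: "real (hilbert_function (lattice_points ?C) (toric_variety ?C) k) = poly h (real k)" for k
    by (simp add: hilbert_function_cube h_def poly_power add.commute mult.commute)
  have "hilbert_polynomial (lattice_points ?C) (toric_variety ?C) = h"
    unfolding hilbert_polynomial_def h
  proof (rule the_equality)
    fix h' assume "\<forall>\<^sub>F k in sequentially. poly h (real k) = poly h' (real k)"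
    then show "h' = h" by (metis poly_eqI_eventually)
  qed simp
  moreover have "degree h = CARD('d)"
    by (simp add: h_def degree_power_eq)
  moreover have "lead_coeff h = 2 ^ CARD('d)"
    unfolding h_def lead_coeff_power by simp
  ultimately show ?thesis by (simp add: polytope_degree_def cone_degree_def)
qed


section \<open>The maximum likelihood degree of the cube\<close>

text \<open>
  Two monomials with the same degree and weight have the same pullback to the torus, so their
  difference belongs to the ideal of the variety.
\<close>

lemma toric_variety_binomial:
  fixes P :: "(real ^ 'd::finite) set"
  assumes "p \<in> toric_variety P"
    and "Poly_Mapping.keys m \<subseteq> lattice_points P" "Poly_Mapping.keys n \<subseteq> lattice_points P"
    and "total_degree m = total_degree n" "lattice_weight m = lattice_weight n"
  shows "monom_eval p m = monom_eval p n"
proof (cases "m = n")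
  case False
  define f where "f = Poly_Mapping.single m (1::complex) - Poly_Mapping.single n 1"
  have keys: "Poly_Mapping.keys f \<subseteq> {m, n}"
    using keys_diff[of "Poly_Mapping.single m (1::complex)" "Poly_Mapping.single n 1"]
    by (simp add: f_def insert_commute)
  have eval: "cpoly_eval q f = monom_eval q m - monom_eval q n" for q
    using False cpoly_eval_superset[OF _ keys, of q]
    by (simp add: f_def lookup_minus lookup_single when_def)
  have "f \<in> cpolys (lattice_points P)" using keys assms(2,3) by (auto simp: cpolys_def)
  moreover have "cpoly_eval (toric_map P s \<theta>) f = 0" if "\<And>i. \<theta> $ i \<noteq> 0" for s \<theta>
    using assms(2-5) that by (simp add: eval monom_eval_toric_map)
  ultimately have "f \<in> vanishing_ideal (lattice_points P) (torus_image P)"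
    by (auto simp: vanishing_ideal_def torus_image_def)
  with assms(1) have "cpoly_eval p f = 0"
    by (simp add: toric_variety_def zariski_closure_def torus_image_def)
  then show ?thesis by (simp add: eval)
qed simp

lemma axis_in_cube: "c \<in> {-1, 0, 1} \<Longrightarrow> axis i c \<in> lattice_points (cube :: (real ^ 'd::finite) set)"
  by (auto simp: lattice_points_cube axis_def)

lemma sum_axis: "(\<Sum>i\<in>UNIV. axis i (a $ i)) = (a :: int ^ 'd::finite)"
  by (simp add: vec_eq_iff axis_def if_distrib cong: if_cong)

text \<open>
  The points of the variety without zero coordinates all come from the torus, which turns the score
  equations into equations for \<open>s\<close> and \<open>\<theta>\<close>. As \<open>0\<close> and the unit vectors are lattice points, \<open>s\<close> and \<open>\<theta>\<close>
  are forced. Two families of binomials then determine all other coordinates of \<open>p\<close>: the relation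
  between the lattice points \<open>e\<^sub>i\<close>, \<open>-e\<^sub>i\<close> and \<open>0\<close>, and the one that decomposes a lattice point into its
  coordinate vectors.
\<close>

lemma cube_variety_torus_point:
  fixes p :: "int ^ 'd::finite \<Rightarrow> complex"
  assumes p: "p \<in> toric_variety (cube :: (real ^ 'd) set)"
    and nz: "\<And>a. a \<in> lattice_points (cube :: (real ^ 'd) set) \<Longrightarrow> p a \<noteq> 0"
  shows "p = toric_map cube (p 0) (\<chi> i. p (axis i 1) / p 0)"
proof -
  let ?I = "lattice_points (cube :: (real ^ 'd) set)"
  define \<theta> where "\<theta> = (\<chi> i. p (axis i 1) / p 0)"
  have 0: "0 \<in> ?I" by (simp add: lattice_points_cube)
  then have p0: "p 0 \<noteq> 0" by (rule nz)
  have ax: "axis i c \<in> ?I" if "c \<in> {-1, 0, 1}" for i c by (rule axis_in_cube[OF that])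
  have keys1: "Poly_Mapping.keys (Poly_Mapping.single a n) \<subseteq> ?I" if "a \<in> ?I" for a and n :: nat
    using that by simp
  have keys_add': "Poly_Mapping.keys (m + n) \<subseteq> ?I"
    if "Poly_Mapping.keys m \<subseteq> ?I" "Poly_Mapping.keys n \<subseteq> ?I" for m n :: "(int ^ 'd) monom"
    using Poly_Mapping.keys_add[of m n] that by blast
  have keys_sum': "Poly_Mapping.keys (\<Sum>i\<in>UNIV. f i) \<subseteq> ?I"
    if "\<And>i. Poly_Mapping.keys (f i) \<subseteq> ?I" for f :: "'d \<Rightarrow> (int ^ 'd) monom"
    using keys_sum[of f UNIV] that by blast
  let ?x = "\<lambda>a :: int ^ 'd. Poly_Mapping.single a (Suc 0)"
  have axis_powi: "p (axis i c) / p 0 = \<theta> $ i powi c" if c: "c \<in> {-1, 0, 1}" for i c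
  proof -
    have "axis i 1 + axis i (- 1) = (0 :: int ^ 'd)" by (simp add: vec_eq_iff axis_def)
    then have "monom_eval p (?x (axis i 1) + ?x (axis i (-1))) = monom_eval p (?x 0 + ?x 0)"
      by (intro toric_variety_binomial[OF p] keys_add' keys1 0 ax)
        (simp_all add: total_degree_add lattice_weight_add)
    then have "p (axis i 1) * p (axis i (-1)) = p 0 * p 0"
      by (simp add: monom_eval_add)
    moreover have "p (axis i 1) \<noteq> 0" by (rule nz) (simp add: ax)
    ultimately have "p (axis i (-1)) / p 0 = p 0 / p (axis i 1)"
      using p0 by (simp add: field_simps)
    moreover have axis0: "axis i 0 = (0 :: int ^ 'd)" by (simp add: vec_eq_iff axis_def)
    ultimately show ?thesis using c p0 by (auto simp: \<theta>_def power_int_minus axis0)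
  qed
  have "p a = p 0 * (\<Prod>i\<in>UNIV. \<theta> $ i powi (a $ i))" if a: "a \<in> ?I" for a
  proof -
    have ai: "a $ i \<in> {-1, 0, 1}" for i using a by (simp add: lattice_points_cube)
    \<comment> \<open>Copies of the lattice point \<open>0\<close> do not change the weight; they pad the two sides to equal degree.\<close>
    have "monom_eval p (?x a + (\<Sum>i\<in>(UNIV :: 'd set). ?x 0)) =
        monom_eval p (?x 0 + (\<Sum>i\<in>UNIV. ?x (axis i (a $ i))))"
      by (intro toric_variety_binomial[OF p] keys_add' keys_sum' keys1 0 ax a ai)
        (simp_all add: total_degree_add lattice_weight_add monom_sum sum_axis del: sum_constant)
    then have "p a * (\<Prod>i\<in>(UNIV :: 'd set). p 0) = p 0 * (\<Prod>i\<in>UNIV. p (axis i (a $ i)))"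
      by (simp add: monom_eval_add monom_sum del: sum_constant prod_constant)
    then have "p a = p 0 * (\<Prod>i\<in>UNIV. p (axis i (a $ i)) / p 0)"
      using p0 by (simp add: prod_dividef field_simps)
    also have "(\<Prod>i\<in>UNIV. p (axis i (a $ i)) / p 0) = (\<Prod>i\<in>UNIV. \<theta> $ i powi (a $ i))"
      by (intro prod.cong refl axis_powi ai)
    finally show ?thesis .
  qed
  moreover have "p \<in> ?I \<rightarrow>\<^sub>E UNIV"
    using p by (simp add: toric_variety_def zariski_closure_def)
  ultimately have "p = toric_map cube (p 0) \<theta>"
    by (intro ext) (auto simp: toric_map_def design_matrix_def PiE_def extensional_def)
  then show ?thesis by (simp add: \<theta>_def)
qed

lemma toric_map_cube_0: "toric_map (cube :: (real ^ 'd::finite) set) s \<theta> 0 = s"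
  by (simp add: toric_map_def lattice_points_cube design_matrix_def)

lemma toric_map_cube_axis:
  "toric_map (cube :: (real ^ 'd::finite) set) s \<theta> (axis i 1) = s * \<theta> $ i"
proof -
  have "(\<Prod>j\<in>UNIV. \<theta> $ j powi (axis i 1 $ j)) = (\<Prod>j\<in>UNIV. if j = i then \<theta> $ j else 1)"
    by (intro prod.cong) (auto simp: axis_def)
  then show ?thesis
    by (simp add: toric_map_def axis_in_cube design_matrix_def)
qed

text \<open>
  The generating function of the lattice points of a segment. Its product over all coordinates is the
  generating function of the cube.
\<close>

definition trinomial :: "complex \<Rightarrow> complex" where
  "trinomial t = inverse t + 1 + t"

lemma sum_lattice_points_cube:
  fixes h :: "'d::finite \<Rightarrow> int \<Rightarrow> complex"
  shows "(\<Sum>a\<in>lattice_points (cube :: (real ^ 'd) set). \<Prod>i\<in>UNIV. h i (a $ i)) =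
    (\<Prod>i\<in>UNIV. h i (-1) + h i 0 + h i 1)"
proof -
  have "(\<Sum>a\<in>lattice_points (cube :: (real ^ 'd) set). \<Prod>i\<in>UNIV. h i (a $ i)) =
      (\<Sum>g\<in>PiE UNIV (\<lambda>_. {-1, 0, 1}). \<Prod>i\<in>UNIV. h i (g i))"
    using sum.reindex_bij_betw[OF bij_betw_vec_lambda_PiE[of "\<lambda>_::'d. {-1, 0, 1 :: int}"],
        of "\<lambda>a. \<Prod>i\<in>UNIV. h i (a $ i)"]
    by (simp add: lattice_points_cube)
  also have "\<dots> = (\<Prod>i\<in>UNIV. \<Sum>c\<in>{-1, 0, 1}. h i c)"
    by (rule prod_sum_PiE[symmetric]) auto
  finally show ?thesis by (simp add: add.assoc)
qed

lemma sum_toric_map_cube: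
  "(\<Sum>a\<in>lattice_points cube. toric_map cube s \<theta> a) = s * (\<Prod>i\<in>UNIV. trinomial (\<theta> $ i))"
  for \<theta> :: "complex ^ 'd::finite"
  using sum_lattice_points_cube[of "\<lambda>i c. \<theta> $ i powi c"]
  by (simp add: toric_map_def design_matrix_def trinomial_def power_int_minus flip: sum_distrib_left)

text \<open>
  Weighting the terms by the coordinate \<open>a $ j\<close> only affects the \<open>j\<close>-th factor of the product, where
  \<open>inverse t + 1 + t\<close> is replaced by \<open>t - inverse t\<close>.
\<close>

lemma sum_coordinate_toric_map_cube:
  fixes \<theta> :: "complex ^ 'd::finite"
  shows "(\<Sum>a\<in>lattice_points cube. of_int (a $ j) * toric_map cube s \<theta> a) =
    s * (\<theta> $ j - inverse (\<theta> $ j)) * (\<Prod>i\<in>UNIV - {j}. trinomial (\<theta> $ i))"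
proof -
  define h where "h i c = (if i = j then of_int c else 1) * \<theta> $ i powi c" for i c
  have "of_int (a $ j) * toric_map cube s \<theta> a = s * (\<Prod>i\<in>UNIV. h i (a $ i))"
    if "a \<in> lattice_points cube" for a
    using that by (simp add: h_def prod.distrib toric_map_def design_matrix_def mult_ac)
  then have "(\<Sum>a\<in>lattice_points cube. of_int (a $ j) * toric_map cube s \<theta> a) =
      s * (\<Prod>i\<in>UNIV. h i (-1) + h i 0 + h i 1)"
    by (simp add: sum_lattice_points_cube[of h] flip: sum_distrib_left)
  also have "(\<Prod>i\<in>UNIV. h i (-1) + h i 0 + h i 1) =
      (h j (-1) + h j 0 + h j 1) * (\<Prod>i\<in>UNIV - {j}. h i (-1) + h i 0 + h i 1)"
    by (rule prod.remove) auto
  also have "(\<Prod>i\<in>UNIV - {j}. h i (-1) + h i 0 + h i 1) = (\<Prod>i\<in>UNIV - {j}. trinomial (\<theta> $ i))"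
    by (intro prod.cong) (auto simp: h_def trinomial_def power_int_minus)
  also have "h j (-1) + h j 0 + h j 1 = \<theta> $ j - inverse (\<theta> $ j)"
    by (simp add: h_def power_int_minus)
  finally show ?thesis by (simp add: mult.assoc)
qed

text \<open>
  The score equation of a single segment with empirical mean \<open>b\<close>, after elimination of \<open>s\<close>.
\<close>

definition score_roots :: "real \<Rightarrow> complex set" where
  "score_roots b = {t. t \<noteq> 0 \<and> t - inverse t = of_real b * trinomial t}"

text \<open>
  If \<open>trinomial t\<close> vanished, then so would \<open>t - inverse t\<close>, forcing \<open>t\<close> to be 1 or -1, where the trinomial
  takes the values 3 and -1.
\<close>

lemma trinomial_score_root_nonzero:
  assumes "t \<in> score_roots b"
  shows "trinomial t \<noteq> 0"
proof
  assume "trinomial t = 0"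
  with assms have t: "t \<noteq> 0" "t = inverse t" "inverse t + 1 + t = 0"
    by (simp_all add: score_roots_def trinomial_def)
  then have "t * t = 1" by (metis right_inverse)
  moreover have "1 + 2 * t = 0" using t(2,3) by (metis add.commute add.left_commute mult_2)
  ultimately show False by algebra
qed

text \<open>
  Multiplying the equation by \<open>t\<close> gives \<open>(1 - b) * t\<^sup>2 - b * t - (1 + b) = 0\<close>. Its discriminant
  \<open>4 - 3 * b\<^sup>2\<close> is positive, and neither the leading nor the constant coefficient vanishes, so that it
  has two distinct roots, both nonzero.
\<close>

lemma card_score_roots:
  assumes "\<bar>b\<bar> < 1"
  shows "finite (score_roots b)" "card (score_roots b) = 2"
proof -
  define D where "D = sqrt (4 - 3 * b\<^sup>2)"
  have "b\<^sup>2 < 1" using assms by (simp add: abs_square_less_1)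
  then have D: "D > 0" "D\<^sup>2 = 4 - 3 * b\<^sup>2" by (simp_all add: D_def)
  define r where "r \<sigma> = complex_of_real ((b + \<sigma> * D) / (2 * (1 - b)))" for \<sigma> :: real
  have b: "1 - b > 0" "1 + b > 0" using assms by auto
  have "t \<in> score_roots b \<longleftrightarrow> t = r 1 \<or> t = r (-1)" for t
  proof -
    let ?b = "complex_of_real b" and ?D = "complex_of_real D"
    have b': "1 - ?b \<noteq> 0" "1 + ?b \<noteq> 0"
      using b of_real_eq_0_iff[of "1 - b", where 'a = complex] of_real_eq_0_iff[of "1 + b", where 'a = complex]
      by auto
    have D': "?D * ?D = 4 - 3 * (?b * ?b)"
      using arg_cong[OF D(2), of complex_of_real] by (simp add: power2_eq_square)
    have sq: "(2 * (1 - ?b) * t - ?b - ?D) * (2 * (1 - ?b) * t - ?b + ?D) =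
        4 * (1 - ?b) * ((1 - ?b) * t * t - ?b * t - (1 + ?b))"
      using D' by algebra
    have "t \<in> score_roots b \<longleftrightarrow> (1 - ?b) * t * t - ?b * t - (1 + ?b) = 0"
    proof (cases "t = 0")
      case True
      then show ?thesis using b'(2) by (auto simp: score_roots_def add_eq_0_iff)
    next
      case False
      then show ?thesis by (simp add: score_roots_def trinomial_def field_simps; algebra)
    qed
    also have "\<dots> \<longleftrightarrow> 2 * (1 - ?b) * t - ?b - ?D = 0 \<or> 2 * (1 - ?b) * t - ?b + ?D = 0"
      using sq b'(1) by (metis mult_eq_0_iff zero_neq_numeral)
    also have "2 * (1 - ?b) * t - ?b - ?D = 0 \<longleftrightarrow> t = r 1"
      using b'(1) by (simp add: r_def eq_divide_eq algebra_simps)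
    also have "2 * (1 - ?b) * t - ?b + ?D = 0 \<longleftrightarrow> t = r (-1)"
      using b'(1) by (simp add: r_def eq_divide_eq algebra_simps)
    finally show ?thesis .
  qed
  then have eq: "score_roots b = {r 1, r (-1)}" by blast
  have "r 1 \<noteq> r (-1)"
    using D(1) b by (simp add: r_def del: of_real_divide)
  then show "finite (score_roots b)" "card (score_roots b) = 2" by (simp_all add: eq)
qed

definition empirical_mean :: "(real ^ 'd::finite) set \<Rightarrow> (int ^ 'd \<Rightarrow> nat) \<Rightarrow> 'd \<Rightarrow> real" where
  "empirical_mean P u j =
     (\<Sum>a\<in>lattice_points P. of_int (a $ j) * of_nat (u a)) / of_nat (\<Sum>a\<in>lattice_points P. u a)"

lemma sum_cube_pos:
  assumes "u 0 \<noteq> 0"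
  shows "0 < (\<Sum>a\<in>lattice_points (cube :: (real ^ 'd::finite) set). u a :: nat)"
proof -
  have "u 0 \<le> (\<Sum>a\<in>lattice_points (cube :: (real ^ 'd) set). u a)"
    by (rule member_le_sum) (simp_all add: finite_lattice_points_cube, simp add: lattice_points_cube)
  then show ?thesis using assms by simp
qed

text \<open>
  The mean is a weighted average of numbers in \<open>{-1, 0, 1}\<close>, and the number \<open>0\<close> receives positive weight
  from the observations at the lattice point \<open>0\<close>.
\<close>

lemma abs_empirical_mean_cube:
  assumes "u 0 \<noteq> 0"
  shows "\<bar>empirical_mean (cube :: (real ^ 'd::finite) set) u j\<bar> < 1"
proof -
  let ?I = "lattice_points (cube :: (real ^ 'd) set)"
  have pos: "0 < real (\<Sum>a\<in>?I. u a)" using sum_cube_pos[of u, OF assms] by (simp only: of_nat_0_less_iff)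
  have "\<bar>\<Sum>a\<in>?I. of_int (a $ j) * real (u a)\<bar> \<le> (\<Sum>a\<in>?I. \<bar>of_int (a $ j) * real (u a)\<bar>)"
    by (rule sum_abs)
  also have "\<dots> < (\<Sum>a\<in>?I. real (u a))"
  proof (rule sum_strict_mono_ex1[OF finite_lattice_points_cube])
    show "\<forall>a\<in>?I. \<bar>of_int (a $ j) * real (u a)\<bar> \<le> real (u a)"
    proof
      fix a assume "a \<in> ?I"
      then have "a $ j \<in> {-1, 0, 1}" by (simp add: lattice_points_cube)
      then show "\<bar>of_int (a $ j) * real (u a)\<bar> \<le> real (u a)" by auto
    qed
    show "\<exists>a\<in>?I. \<bar>of_int (a $ j) * real (u a)\<bar> < real (u a)"
      by (rule bexI[of _ 0]) (use assms in \<open>simp_all add: lattice_points_cube\<close>)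
  qed
  finally show ?thesis using pos by (simp add: empirical_mean_def)
qed

text \<open>
  Because the generating function of the cube is a product, dividing the score equation of coordinate
  \<open>j\<close> by that of the total mass cancels all factors except the \<open>j\<close>-th. What remains is the equation of a
  segment in \<open>\<theta> $ j\<close> alone, and the total mass equation determines \<open>s\<close>.
\<close>

lemma score_solutions_cube:
  fixes u :: "int ^ 'd::finite \<Rightarrow> nat"
  assumes u0: "u 0 \<noteq> 0"
  shows "score_solutions (cube :: (real ^ 'd) set) u =
    (\<lambda>\<theta>. toric_map cube (inverse (\<Prod>i\<in>UNIV. trinomial (\<theta> $ i))) \<theta>) `
      {\<theta>. \<forall>i. \<theta> $ i \<in> score_roots (empirical_mean (cube :: (real ^ 'd) set) u i)}"
    (is "?S = ?F ` ?R")
proof -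
  let ?C = "cube :: (real ^ 'd) set"
  let ?I = "lattice_points ?C" and ?b = "empirical_mean ?C u"
  let ?score = "\<lambda>p :: int ^ 'd \<Rightarrow> complex. \<forall>r. (\<Sum>a\<in>?I. of_int (extended_design_matrix r a) * p a) =
          1 / of_nat (\<Sum>a\<in>?I. u a) *
          (\<Sum>a\<in>?I. of_int (extended_design_matrix r a) * of_nat (u a))"
  have U: "(of_nat (\<Sum>a\<in>?I. u a) :: complex) \<noteq> 0"
    using sum_cube_pos[of u, OF u0] by (simp only: of_nat_eq_0_iff)
  have mean: "1 / of_nat (\<Sum>a\<in>?I. u a) * (\<Sum>a\<in>?I. of_int (a $ j) * of_nat (u a)) =
      complex_of_real (?b j)" for j
    by (simp add: empirical_mean_def)
  have score_iff: "?score (toric_map ?C s \<theta>) \<longleftrightarrow>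
      s * (\<Prod>i\<in>UNIV. trinomial (\<theta> $ i)) = 1 \<and>
      (\<forall>j. s * (\<theta> $ j - inverse (\<theta> $ j)) * (\<Prod>i\<in>UNIV - {j}. trinomial (\<theta> $ i)) = of_real (?b j))"
    for s \<theta>
    unfolding split_option_all extended_design_matrix.simps design_matrix_def
      sum_coordinate_toric_map_cube mean
    using U by (simp add: sum_toric_map_cube)
  have split: "(\<Prod>i\<in>UNIV. trinomial (\<theta> $ i)) = trinomial (\<theta> $ j) * (\<Prod>i\<in>UNIV - {j}. trinomial (\<theta> $ i))"
    for \<theta> :: "complex ^ 'd" and j
    by (rule prod.remove) auto
  show ?thesis
  proof (intro equalityI subsetI)
    fix p assume p: "p \<in> ?S"
    define s where "s = p 0"
    define \<theta> where "\<theta> = (\<chi> i. p (axis i 1) / p 0)"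
    have nz: "p a \<noteq> 0" if "a \<in> ?I" for a using p that by (simp add: score_solutions_def)
    have p_eq: "p = toric_map ?C s \<theta>"
      unfolding s_def \<theta>_def
      by (rule cube_variety_torus_point) (use p in \<open>auto simp: score_solutions_def\<close>)
    have \<theta>0: "\<theta> $ i \<noteq> 0" for i
      using nz[of 0] nz[of "axis i 1"] by (simp add: \<theta>_def lattice_points_cube axis_def)
    have s: "s * (\<Prod>i\<in>UNIV. trinomial (\<theta> $ i)) = 1"
      and eq: "\<And>j. s * (\<theta> $ j - inverse (\<theta> $ j)) * (\<Prod>i\<in>UNIV - {j}. trinomial (\<theta> $ i)) = of_real (?b j)"
      using p score_iff[of s \<theta>] by (simp_all add: score_solutions_def p_eq)
    have "\<theta> $ j \<in> score_roots (?b j)" for j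
    proof -
      have "of_real (?b j) * trinomial (\<theta> $ j) =
          (\<theta> $ j - inverse (\<theta> $ j)) * (s * (\<Prod>i\<in>UNIV. trinomial (\<theta> $ i)))"
        by (simp add: eq[symmetric] split[of \<theta> j] mult_ac)
      then show ?thesis using \<theta>0 by (simp add: s score_roots_def)
    qed
    moreover have "s = inverse (\<Prod>i\<in>UNIV. trinomial (\<theta> $ i))"
      using s by (metis inverse_unique mult.commute)
    ultimately show "p \<in> ?F ` ?R" using p_eq by blast
  next
    fix p assume "p \<in> ?F ` ?R"
    then obtain \<theta> where p: "p = ?F \<theta>" and \<theta>: "\<And>i. \<theta> $ i \<in> score_roots (?b i)" by blast
    define s where "s = inverse (\<Prod>i\<in>UNIV. trinomial (\<theta> $ i))"
    have p_eq: "p = toric_map ?C s \<theta>" by (simp add: p s_def)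
    have \<theta>0: "\<theta> $ i \<noteq> 0" for i using \<theta>[of i] by (simp add: score_roots_def)
    have g0: "trinomial (\<theta> $ i) \<noteq> 0" for i by (rule trinomial_score_root_nonzero[OF \<theta>])
    then have prod0: "(\<Prod>i\<in>UNIV. trinomial (\<theta> $ i)) \<noteq> 0" by simp
    then have s: "s \<noteq> 0" "s * (\<Prod>i\<in>UNIV. trinomial (\<theta> $ i)) = 1" by (simp_all add: s_def)
    have "p \<in> torus_image ?C" using s(1) \<theta>0 p_eq by (auto simp: torus_image_def)
    then have "p \<in> toric_variety ?C"
      using zariski_closure_superset[OF torus_image_subset_PiE[of ?C]]
      by (auto simp: toric_variety_def torus_image_def)
    moreover have "p a \<noteq> 0" if "a \<in> ?I" for a
      using that s(1) \<theta>0 by (simp add: p_eq toric_map_def)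
    moreover have "s * (\<theta> $ j - inverse (\<theta> $ j)) * (\<Prod>i\<in>UNIV - {j}. trinomial (\<theta> $ i)) = of_real (?b j)" for j
    proof -
      have "\<theta> $ j - inverse (\<theta> $ j) = of_real (?b j) * trinomial (\<theta> $ j)"
        using \<theta>[of j] by (simp add: score_roots_def)
      then have "s * (\<theta> $ j - inverse (\<theta> $ j)) * (\<Prod>i\<in>UNIV - {j}. trinomial (\<theta> $ i)) =
          of_real (?b j) * (s * (\<Prod>i\<in>UNIV. trinomial (\<theta> $ i)))"
        by (simp add: split[of \<theta> j] mult_ac)
      then show ?thesis by (simp add: s(2))
    qed
    ultimately show "p \<in> ?S"
      using score_iff[of s \<theta>] s(2) by (simp add: score_solutions_def p_eq)
  qed
qed

lemma card_score_solutions_cube: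
  fixes u :: "int ^ 'd::finite \<Rightarrow> nat"
  assumes "u 0 \<noteq> 0"
  shows "finite (score_solutions (cube :: (real ^ 'd) set) u) \<and>
    card (score_solutions (cube :: (real ^ 'd) set) u) = 2 ^ CARD('d)"
proof -
  let ?R = "{\<theta> :: complex ^ 'd. \<forall>i. \<theta> $ i \<in> score_roots (empirical_mean (cube :: (real ^ 'd) set) u i)}"
  let ?F = "\<lambda>\<theta>. toric_map (cube :: (real ^ 'd) set) (inverse (\<Prod>i\<in>UNIV. trinomial (\<theta> $ i))) \<theta>"
  note roots = card_score_roots[OF abs_empirical_mean_cube[of u, OF assms]]
  have R: "finite ?R" "card ?R = 2 ^ CARD('d)"
    using finite_card_vec_box[of "\<lambda>i. score_roots (empirical_mean (cube :: (real ^ 'd) set) u i)"]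
    by (simp_all add: roots)
  have "inj_on ?F ?R"
  proof (rule inj_onI)
    fix \<theta> \<eta> assume \<theta>: "\<theta> \<in> ?R" and "\<eta> \<in> ?R" and eq: "?F \<theta> = ?F \<eta>"
    have "inverse (\<Prod>i\<in>UNIV. trinomial (\<theta> $ i)) = inverse (\<Prod>i\<in>UNIV. trinomial (\<eta> $ i))"
      using fun_cong[OF eq, of 0] by (simp only: toric_map_cube_0)
    moreover have "inverse (\<Prod>i\<in>UNIV. trinomial (\<theta> $ i)) \<noteq> 0"
      using \<theta> trinomial_score_root_nonzero by auto
    ultimately have "\<theta> $ i = \<eta> $ i" for i
      using fun_cong[OF eq, of "axis i 1"] unfolding toric_map_cube_axis by (metis mult_cancel_left)
    then show "\<theta> = \<eta>" by (simp add: vec_eq_iff)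
  qed
  then show ?thesis
    using R by (simp add: score_solutions_cube[of u, OF assms] card_image)
qed

text \<open>
  The excluded hypersurface of data is a coordinate hyperplane: the number of observations at the
  lattice point \<open>0\<close> must not be zero.
\<close>

theorem mldeg_cube: "mldeg (cube :: (real ^ 'd::finite) set) = 2 ^ CARD('d)"
proof -
  let ?C = "cube :: (real ^ 'd) set"
  let ?Q = "\<lambda>N u. finite (score_solutions ?C u) \<and> card (score_solutions ?C u) = N"
  have gen: "generic_data (lattice_points ?C) (?Q (2 ^ CARD('d)))"
    unfolding generic_data_def
  proof (intro bexI conjI ballI impI)
    let ?g = "Poly_Mapping.single (Poly_Mapping.single (0 :: int ^ 'd) 1) (1 :: complex)"
    show "?g \<in> cpolys (lattice_points ?C)" by (simp add: cpolys_def lattice_points_cube)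
    show "?g \<noteq> 0" by (simp flip: keys_eq_empty)
    fix u :: "int ^ 'd \<Rightarrow> nat" assume "cpoly_eval (\<lambda>a. of_nat (u a)) ?g \<noteq> 0"
    then have "u 0 \<noteq> 0" by (simp add: cpoly_eval_single)
    then show "finite (score_solutions ?C u)" "card (score_solutions ?C u) = 2 ^ CARD('d)"
      using card_score_solutions_cube by auto
  qed
  show ?thesis
    unfolding mldeg_def
  proof (rule the_equality[of "\<lambda>N. generic_data (lattice_points ?C) (?Q N)", OF gen])
    fix N assume "generic_data (lattice_points ?C) (?Q N)"
    from generic_data_compatible[OF finite_lattice_points_cube this gen] show "N = 2 ^ CARD('d)" by auto
  qed
qed

theorem corollary5p2:
  assumes "CARD('d::finite) > 1"
  shows "real (mldeg (cube :: (real ^ 'd) set)) < polytope_degree (cube :: (real ^ 'd) set)"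
proof -
  have "(1 :: real) < fact CARD('d)"
    using fact_mono[of 2 "CARD('d)", where 'a = real] assms by simp
  then show ?thesis by (simp add: mldeg_cube polytope_degree_cube)
qed

end
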